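(* Let $M_{A,B,C}\in\mathrm{Sp}^{\mathcal I}(4)$ be such that $A$ has two distinct real eigenvalues, both different from $\pm1$, and let $\mu$ be an eigenvalue of $A$ with $-1<\mu<1$. Let $\lambda=\mu+i\sqrt{1-\mu^2}$, which is an eigenvalue of $M_{A,B,C}$. Then $\mu$ is $B$-positive (respectively $B$-negative) if and only if the eigenvalue $\lambda$ of $M_{A,B,C}$ is Krein-positive (respectively Krein-negative).
   Context: $\mathrm{Sp}(4)$ is the group of real $4\times4$ matrices with $M^TJM=J$, $J=\begin{pmatrix}0&I\\-I&0\end{pmatrix}$. $\mathrm{Sp}^{\mathcal I}(4)$ is the set of symplectic matrices $M_{A,B,C}=\begin{pmatrix}A&B\\C&A^T\end{pmatrix}$ with $A,B,C\in\mathrm{M}_{2\times2}(\mathbb{R})$ satisfying $B=B^T$, $C=C^T$, $AB=BA^T$, $A^TC=CA$, $A^2-BC=I$. The group $\mathrm{GL}_2(\mathbb{R})$ acts by $R_*(A,B,C)=(RAR^{-1},RBR^T,(R^T)^{-1}CR^{-1})$. $B$-sign: suppose $A$ has two distinct real eigenvalues. Choose $R\in\mathrm{GL}_2(\mathbb{R})$ such that $RAR^{-1}$ is diagonal; then $RBR^T$ commutes with $RAR^{-1}$ and hence is diagonal. For an eigenvalue $\mu$ of $A$, let $b_\mu$ be the diagonal entry of $RBR^T$ in the position where $RAR^{-1}$ has entry $\mu$. The sign of $b_\mu$ does not depend on $R$. The eigenvalue $\mu$ is called $B$-positive if $b_\mu>0$ and $B$-negative if $b_\mu<0$. Krein sign: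 on $\mathbb{C}^{4}$ let $G(x,y)=\langle -iJx,y\rangle$, where $\langle x,y\rangle=\sum_k x_k\overline{y_k}$. For an eigenvalue $\lambda$ of a symplectic matrix $M$ with $|\lambda|=1$, let $E_\lambda=\bigcup_{m\ge1}\ker(M-\lambda I)^m\subset\mathbb{C}^4$. Then $\lambda$ is Krein-positive if $G|_{E_\lambda}$ is positive definite and Krein-negative if $G|_{E_\lambda}$ is negative definite. *)

theory Defs
  imports "Jordan_Normal_Form.Spectral_Radius" "Jordan_Normal_Form.Matrix_Kernel"
begin

definition J4 :: "'a :: ring_1 mat" where
  "J4 = four_block_mat (0\<^sub>m 2 2) (1\<^sub>m 2) (- 1\<^sub>m 2) (0\<^sub>m 2 2)"

definition Sp4 :: "real mat set" where
  "Sp4 = {M \<in> carrier_mat 4 4. transpose_mat M * J4 * M = J4}"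

definition M_block :: "real mat \<Rightarrow> real mat \<Rightarrow> real mat \<Rightarrow> real mat" where
  "M_block A B C = four_block_mat A B C (transpose_mat A)"

definition SpI4 :: "real mat set" where
  "SpI4 = {M_block A B C | A B C.
     A \<in> carrier_mat 2 2 \<and> B \<in> carrier_mat 2 2 \<and> C \<in> carrier_mat 2 2 \<and>
     M_block A B C \<in> Sp4 \<and>
     B = transpose_mat B \<and> C = transpose_mat C \<and>
     A * B = B * transpose_mat A \<and> transpose_mat A * C = C * A \<and>
     A * A - B * C = 1\<^sub>m 2}"

text \<open>\<open>B_entry A B \<mu> b\<close>: some \<open>R\<close> (with inverse \<open>Ri\<close>) diagonalises \<open>A\<close>, and \<open>b\<close> is the diagonal
  entry of \<open>R B R\<^sup>T\<close> at the position of \<open>\<mu>\<close>. If \<open>A\<close> has two distinct real eigenvalues, the sign of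
  \<open>b\<close> does not depend on \<open>R\<close>: see \<open>B_entry_sgn_unique\<close> below.\<close>

definition B_entry :: "real mat \<Rightarrow> real mat \<Rightarrow> real \<Rightarrow> real \<Rightarrow> bool" where
  "B_entry A B \<mu> b \<longleftrightarrow>
     (\<exists>R \<in> carrier_mat 2 2. \<exists>Ri \<in> carrier_mat 2 2. \<exists>i < 2.
        R * Ri = 1\<^sub>m 2 \<and> Ri * R = 1\<^sub>m 2 \<and>
        diagonal_mat (R * A * Ri) \<and> (R * A * Ri) $$ (i, i) = \<mu> \<and>
        b = (R * B * transpose_mat R) $$ (i, i))"

definition B_positive :: "real mat \<Rightarrow> real mat \<Rightarrow> real \<Rightarrow> bool" where
  "B_positive A B \<mu> \<longleftrightarrow> (\<exists>b. B_entry A B \<mu> b \<and> b > 0)"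

definition B_negative :: "real mat \<Rightarrow> real mat \<Rightarrow> real \<Rightarrow> bool" where
  "B_negative A B \<mu> \<longleftrightarrow> (\<exists>b. B_entry A B \<mu> b \<and> b < 0)"

abbreviation cmat :: "real mat \<Rightarrow> complex mat" where
  "cmat \<equiv> map_mat complex_of_real"

definition krein_form :: "complex vec \<Rightarrow> complex vec \<Rightarrow> complex" where
  "krein_form x y = ((- \<i>) \<cdot>\<^sub>v (J4 *\<^sub>v x)) \<bullet>c y"

definition gen_eigenspace :: "real mat \<Rightarrow> complex \<Rightarrow> complex vec set" where
  "gen_eigenspace M l = (\<Union>m \<in> {1..}. mat_kernel ((cmat M - l \<cdot>\<^sub>m 1\<^sub>m 4) ^\<^sub>m m))"

definition krein_positive :: "real mat \<Rightarrow> complex \<Rightarrow> bool" where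
  "krein_positive M l \<longleftrightarrow> eigenvalue (cmat M) l \<and> cmod l = 1 \<and>
     (\<forall>x \<in> gen_eigenspace M l. x \<noteq> 0\<^sub>v 4 \<longrightarrow>
        krein_form x x \<in> \<real> \<and> Re (krein_form x x) > 0)"

definition krein_negative :: "real mat \<Rightarrow> complex \<Rightarrow> bool" where
  "krein_negative M l \<longleftrightarrow> eigenvalue (cmat M) l \<and> cmod l = 1 \<and>
     (\<forall>x \<in> gen_eigenspace M l. x \<noteq> 0\<^sub>v 4 \<longrightarrow>
        krein_form x x \<in> \<real> \<and> Re (krein_form x x) < 0)"

lemma diag_entries_distinct:
  fixes A R Ri :: "real mat"
  assumes A: "A \<in> carrier_mat 2 2" and R: "R \<in> carrier_mat 2 2" and Ri: "Ri \<in> carrier_mat 2 2"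
    and inv: "R * Ri = 1\<^sub>m 2" "Ri * R = 1\<^sub>m 2"
    and diag: "diagonal_mat (R * A * Ri)" and card: "card (spectrum A) = 2"
  shows "(R * A * Ri) $$ (0, 0) \<noteq> (R * A * Ri) $$ (1, 1)"
proof
  let ?D = "R * A * Ri"
  assume eq: "?D $$ (0, 0) = ?D $$ (1, 1)"
  have D: "?D \<in> carrier_mat 2 2" using A R Ri by auto
  have "similar_mat_wit ?D A R Ri"
    unfolding similar_mat_wit_def Let_def using A R Ri D inv by auto
  then have cp: "char_poly ?D = char_poly A"
    by (intro char_poly_similar) (auto simp: similar_mat_def)
  have "upper_triangular ?D"
  proof (rule upper_triangularI)
    fix k m assume "m < k" "k < dim_row ?D"
    then show "?D $$ (k, m) = 0"
      using diag carrier_matD[OF D] unfolding diagonal_mat_def by (metis less_trans less_irrefl)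
  qed
  then have "char_poly ?D = (\<Prod>a \<leftarrow> diag_mat ?D. [:- a, 1:])"
    by (rule char_poly_upper_triangular[OF D])
  also have "diag_mat ?D = [?D $$ (0, 0), ?D $$ (0, 0)]"
    using D eq by (simp add: diag_mat_def upt_rec numeral_2_eq_2 del: index_mult_mat)
  finally have "char_poly A = [:- (?D $$ (0, 0)), 1:] * [:- (?D $$ (0, 0)), 1:]"
    unfolding cp by simp
  then have "poly (char_poly A) k = 0 \<longleftrightarrow> k = ?D $$ (0, 0)" for k
    by (simp only: poly_mult mult_eq_0_iff) (simp del: index_mult_mat)
  then have "spectrum A = {?D $$ (0, 0)}"
    unfolding spectrum_def using eigenvalue_root_char_poly[OF A] by auto
  then show False using card by simp
qed

lemma B_entry_sgn_unique:
  assumes A: "A \<in> carrier_mat 2 2" and B: "B \<in> carrier_mat 2 2"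
    and card: "card (spectrum A) = 2"
    and b: "B_entry A B \<mu> b" and b': "B_entry A B \<mu> b'"
  shows "sgn b = sgn b'"
proof -
  from b obtain R Ri i where R: "R \<in> carrier_mat 2 2" and Ri: "Ri \<in> carrier_mat 2 2"
    and i: "i < 2" and inv: "R * Ri = 1\<^sub>m 2" "Ri * R = 1\<^sub>m 2"
    and diag: "diagonal_mat (R * A * Ri)" and mu: "(R * A * Ri) $$ (i, i) = \<mu>"
    and beq: "b = (R * B * transpose_mat R) $$ (i, i)"
    unfolding B_entry_def by blast
  from b' obtain R' Ri' i' where R': "R' \<in> carrier_mat 2 2" and Ri': "Ri' \<in> carrier_mat 2 2"
    and i': "i' < 2" and inv': "R' * Ri' = 1\<^sub>m 2" "Ri' * R' = 1\<^sub>m 2"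
    and diag': "diagonal_mat (R' * A * Ri')" and mu': "(R' * A * Ri') $$ (i', i') = \<mu>"
    and beq': "b' = (R' * B * transpose_mat R') $$ (i', i')"
    unfolding B_entry_def by blast
  define D where "D = R * A * Ri"
  define D' where "D' = R' * A * Ri'"
  define S where "S = R' * Ri"
  define T where "T = R * Ri'"
  define Q where "Q = R * B * transpose_mat R"
  note dims = A B R Ri R' Ri'
  have D: "D \<in> carrier_mat 2 2" and D': "D' \<in> carrier_mat 2 2" and S: "S \<in> carrier_mat 2 2"
    and T: "T \<in> carrier_mat 2 2" and Q: "Q \<in> carrier_mat 2 2"
    using dims by (auto simp: D_def D'_def S_def T_def Q_def)
  have SR: "S * R = R'"
    unfolding S_def using dims inv by (simp add: assoc_mult_mat[of _ 2 2 _ 2 _ 2])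
  have ST: "S * T = 1\<^sub>m 2"
  proof -
    have "S * T = (S * R) * Ri'"
      unfolding T_def using S dims by (simp add: assoc_mult_mat[of _ 2 2 _ 2 _ 2])
    then show ?thesis using SR inv' by simp
  qed
  have SD: "S * D = D' * S"
  proof -
    have "S * D = (S * R) * (A * Ri)"
      unfolding D_def using S dims by (simp add: assoc_mult_mat[of _ 2 2 _ 2 _ 2])
    also have "\<dots> = R' * A * (Ri' * R') * Ri"
      using SR inv' dims by (simp add: assoc_mult_mat[of _ 2 2 _ 2 _ 2])
    also have "\<dots> = D' * S"
      unfolding D'_def S_def using dims by (simp add: assoc_mult_mat[of _ 2 2 _ 2 _ 2] mult_carrier_mat[of _ 2 2 _ 2])
    finally show ?thesis .
  qed
  have ent: "(X * Y) $$ (k, l) = X $$ (k, 0) * Y $$ (0, l) + X $$ (k, 1) * Y $$ (1, l)"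
    if "X \<in> carrier_mat 2 2" "Y \<in> carrier_mat 2 2" "k < 2" "l < 2" for X Y :: "real mat" and k l
    using that by (simp add: scalar_prod_def numeral_2_eq_2)
  have ne: "D $$ (0, 0) \<noteq> D $$ (1, 1)"
    unfolding D_def by (rule diag_entries_distinct[OF A R Ri inv diag card])
  have D0: "D $$ (k, l) = 0" "D' $$ (k, l) = 0" if "k < 2" "l < 2" "k \<noteq> l" for k l
    using diag diag' D D' that unfolding D_def[symmetric] D'_def[symmetric] diagonal_mat_def by auto
  define j where "j = 1 - i"
  have ij: "i = 0 \<and> j = 1 \<or> i = 1 \<and> j = 0" and j: "j < 2" using i j_def by auto
  have ij': "i' = 0 \<or> i' = 1" using i' by auto
  have Sj: "S $$ (i', j) = 0"
  proof -
    have "(S * D) $$ (i', j) = (D' * S) $$ (i', j)" using SD by simp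
    then have "S $$ (i', j) * D $$ (j, j) = \<mu> * S $$ (i', j)"
      using ent[OF S D i' j] ent[OF D' S i' j] ij ij' D0 mu' by (auto simp: D'_def)
    then show ?thesis using ne ij mu by (auto simp: D_def)
  qed
  have Si: "S $$ (i', i) \<noteq> 0"
  proof
    assume z: "S $$ (i', i) = 0"
    have "(S * T) $$ (i', i') = 0" using ent[OF S T i' i'] ij Sj z by auto
    then show False using ST i' by simp
  qed
  have "R' * B * transpose_mat R' = S * Q * transpose_mat S"
  proof -
    have "transpose_mat R' = transpose_mat R * transpose_mat S"
      using SR transpose_mult[OF S R] by simp
    then show ?thesis
      unfolding Q_def SR[symmetric] using S R B
      by (simp add: assoc_mult_mat[of _ 2 2 _ 2 _ 2] mult_carrier_mat[of _ 2 2 _ 2])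
  qed
  then have "b' = (S * Q * transpose_mat S) $$ (i', i')" using beq' by simp
  also have "\<dots> = (S $$ (i', i))\<^sup>2 * Q $$ (i, i)"
    using ent[of "S * Q" "transpose_mat S" i' i'] ent[OF S Q i'] S Q i' ij Sj
    by (auto simp: power2_eq_square mult_carrier_mat[of _ 2 2 _ 2] simp del: index_mult_mat)
  finally have "b' = (S $$ (i', i))\<^sup>2 * b" using beq Q_def by simp
  moreover have "sgn ((S $$ (i', i))\<^sup>2) = 1" using Si by (intro sgn_pos) simp
  ultimately show ?thesis by (simp only: sgn_mult mult_1_left)
qed

end

theory Submission
  imports Defs
begin

text \<open>
  Let \<open>r\<close> be an eigenvector of \<open>A\<^sup>T\<close> for \<open>\<mu>\<close>, i.e. the \<open>\<mu>\<close>-row of a diagonalising \<open>R\<close>, so that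
  \<open>b\<^sub>\<mu> = r \<bullet> B r\<close>, and let \<open>s = sqrt (1 - \<mu>\<^sup>2)\<close>. From \<open>A B = B A\<^sup>T\<close> and \<open>C B = (A\<^sup>T)\<^sup>2 - I\<close> the vector
  \<open>x\<^sub>0 = (B r, i s r)\<close> is an eigenvector of \<open>M\<close> for \<open>\<lambda>\<close>, and \<open>G(x\<^sub>0, x\<^sub>0) = 2 s b\<^sub>\<mu>\<close>.
  It spans the generalised eigenspace: with \<open>P = diag(A, A\<^sup>T)\<close> one has \<open>M\<^sup>2 + I = 2 P M\<close>, that is
  \<open>P = (M + M\<^sup>-\<^sup>1) / 2\<close>, and \<open>P\<close> is annihilated by \<open>(t - \<mu>) (t - \<nu>)\<close> with \<open>\<mu> \<noteq> \<nu>\<close>. Hence \<open>\<lambda>\<close> is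
  semisimple, and \<open>P x = \<mu> x\<close> together with \<open>M x = \<lambda> x\<close> forces \<open>x\<close> to be a multiple of \<open>x\<^sub>0\<close>.
\<close>

section \<open>Entries of 2 x 2 and block matrices\<close>

lemma mult_mat_vec_index_2:
  assumes "X \<in> carrier_mat 2 2" "x \<in> carrier_vec 2" "k < 2"
  shows "(X *\<^sub>v x) $ k = X $$ (k, 0) * x $ 0 + X $$ (k, 1) * x $ 1"
  using assms by (simp add: scalar_prod_def numeral_2_eq_2)

lemma mult_mat_index_2:
  assumes "X \<in> carrier_mat 2 2" "Y \<in> carrier_mat 2 2" "k < 2" "m < 2"
  shows "(X * Y) $$ (k, m) = X $$ (k, 0) * Y $$ (0, m) + X $$ (k, 1) * Y $$ (1, m)"
  using assms by (simp add: scalar_prod_def numeral_2_eq_2)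

lemma eq_mat_2I:
  assumes "X \<in> carrier_mat 2 2" "Y \<in> carrier_mat 2 2"
    and "X $$ (0, 0) = Y $$ (0, 0)" "X $$ (0, 1) = Y $$ (0, 1)"
    and "X $$ (1, 0) = Y $$ (1, 0)" "X $$ (1, 1) = Y $$ (1, 1)"
  shows "X = Y"
  using assms by (intro eq_matI) (auto simp: less_2_cases_iff)

lemma four_block_mat_mult_vec_index:
  assumes "A \<in> carrier_mat 2 2" "B \<in> carrier_mat 2 2" "C \<in> carrier_mat 2 2" "D \<in> carrier_mat 2 2"
    and "x \<in> carrier_vec 4" and "k < 2"
  shows "(four_block_mat A B C D *\<^sub>v x) $ k =
      A $$ (k, 0) * x $ 0 + A $$ (k, 1) * x $ 1 + (B $$ (k, 0) * x $ 2 + B $$ (k, 1) * x $ 3)"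
    and "(four_block_mat A B C D *\<^sub>v x) $ (k + 2) =
      C $$ (k, 0) * x $ 0 + C $$ (k, 1) * x $ 1 + (D $$ (k, 0) * x $ 2 + D $$ (k, 1) * x $ 3)"
  using assms by (simp_all add: scalar_prod_def eval_nat_numeral add.assoc)

text \<open>Membership in \<open>SpI4\<close> only provides some blocks satisfying the relations;
  since all sizes agree, the partition is unambiguous and those blocks can be identified with the
  given \<open>A\<close>, \<open>B\<close>, \<open>C\<close>.\<close>

lemma four_block_mat_inject:
  assumes "A \<in> carrier_mat n n" "B \<in> carrier_mat n n" "C \<in> carrier_mat n n" "D \<in> carrier_mat n n"
    and "A' \<in> carrier_mat n n" "B' \<in> carrier_mat n n" "C' \<in> carrier_mat n n" "D' \<in> carrier_mat n n"
    and eq: "four_block_mat A B C D = four_block_mat A' B' C' D'"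
  shows "A = A' \<and> B = B' \<and> C = C' \<and> D = D'"
proof -
  have ent: "four_block_mat A B C D $$ (i, j) = four_block_mat A' B' C' D' $$ (i, j)" for i j
    using eq by simp
  have "A $$ (i, j) = A' $$ (i, j)" "B $$ (i, j) = B' $$ (i, j)"
    "C $$ (i, j) = C' $$ (i, j)" "D $$ (i, j) = D' $$ (i, j)" if "i < n" "j < n" for i j
    using ent[of i j] ent[of i "j + n"] ent[of "i + n" j] ent[of "i + n" "j + n"] that assms(1-8)
    by auto
  then show ?thesis using assms(1-8) by (auto intro!: eq_matI)
qed

section \<open>Semisimplicity of an eigenvalue\<close>

text \<open>Once the kernels of \<open>N\<close> and of its square agree, the chain of kernels is
  stationary. The power splits as \<open>N ^\<^sub>m Suc k\<close> applied to
  \<open>N *\<^sub>v x\<close>, so the induction hypothesis is needed at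
  \<open>N *\<^sub>v x\<close>.\<close>

lemma mat_pow_kernel_eq:
  fixes N :: "'a :: comm_ring_1 mat"
  assumes N: "N \<in> carrier_mat n n"
    and step: "\<And>y. y \<in> carrier_vec n \<Longrightarrow> N *\<^sub>v (N *\<^sub>v y) = 0\<^sub>v n \<Longrightarrow> N *\<^sub>v y = 0\<^sub>v n"
    and "x \<in> carrier_vec n" and "N ^\<^sub>m Suc k *\<^sub>v x = 0\<^sub>v n"
  shows "N *\<^sub>v x = 0\<^sub>v n"
  using assms(3-4)
proof (induction k arbitrary: x)
  case 0
  then show ?case using N by simp
next
  case (Suc k)
  have "N ^\<^sub>m Suc k *\<^sub>v (N *\<^sub>v x) = 0\<^sub>v n"
    using Suc.prems N assoc_mult_mat_vec[of "N ^\<^sub>m Suc k" n n N n x]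
    by (simp add: pow_carrier_mat mult_carrier_mat[of _ n n])
  then have "N *\<^sub>v (N *\<^sub>v x) = 0\<^sub>v n" using Suc.IH[of "N *\<^sub>v x"] Suc.prems N by simp
  then show ?case using step Suc.prems by blast
qed

lemma smult_mat_mult_vec:
  fixes X :: "'a :: comm_ring_1 mat"
  assumes "X \<in> carrier_mat nr nc" "x \<in> carrier_vec nc"
  shows "(k \<cdot>\<^sub>m X) *\<^sub>v x = k \<cdot>\<^sub>v (X *\<^sub>v x)"
  using assms by (intro eq_vecI) auto

lemma char_shift_mult_vec:
  fixes M :: "'a :: comm_ring_1 mat"
  assumes "M \<in> carrier_mat n n" "x \<in> carrier_vec n"
  shows "(M - l \<cdot>\<^sub>m 1\<^sub>m n) *\<^sub>v x = M *\<^sub>v x - l \<cdot>\<^sub>v x"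
proof -
  have "(l \<cdot>\<^sub>m 1\<^sub>m n) *\<^sub>v x = l \<cdot>\<^sub>v x"
    using assms smult_mat_mult_vec[of "1\<^sub>m n" n n x l] by simp
  then show ?thesis using assms minus_mult_distrib_mat_vec[of M n n "l \<cdot>\<^sub>m 1\<^sub>m n" x] by simp
qed

(* The method name must be qualified: HOL-Algebra shadows the Groebner basis method algebra. *)
lemma half_trace_eigenvector:
  fixes M P :: "complex mat"
  assumes M: "M \<in> carrier_mat n n" and P: "P \<in> carrier_mat n n"
    and MM: "\<And>y. y \<in> carrier_vec n \<Longrightarrow> M *\<^sub>v (M *\<^sub>v y) + y = 2 \<cdot>\<^sub>v (P *\<^sub>v (M *\<^sub>v y))"
    and l: "l\<^sup>2 + 1 = 2 * l * m" "l \<noteq> 0"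
    and x: "x \<in> carrier_vec n" and ev: "M *\<^sub>v x = l \<cdot>\<^sub>v x"
  shows "P *\<^sub>v x = m \<cdot>\<^sub>v x"
proof
  fix i assume i: "i < dim_vec (m \<cdot>\<^sub>v x)"
  \<comment> \<open>On an eigenvector \<open>MM\<close> reads (l^2 + 1) x = 2 l P x, and l^2 + 1 = 2
    l m allows cancelling 2 l.\<close>
  have "l \<cdot>\<^sub>v (l \<cdot>\<^sub>v x) + x = 2 \<cdot>\<^sub>v (l \<cdot>\<^sub>v (P *\<^sub>v x))"
    using MM[OF x] ev mult_mat_vec[OF M x] mult_mat_vec[OF P x] by simp
  from arg_cong[OF this, of "\<lambda>v. v $ i"]
  have "l * (l * x $ i) + x $ i = 2 * (l * (P *\<^sub>v x) $ i)"
    using i x P by (simp del: index_mult_mat_vec)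
  moreover have "2 * (l * p) = 2 * (l * (m * q))" if "l * (l * q) + q = 2 * (l * p)" for p q
    using l(1) that by Groebner_Basis.algebra
  ultimately have "2 * (l * ((P *\<^sub>v x) $ i)) = 2 * (l * (m * x $ i))" by blast
  then show "(P *\<^sub>v x) $ i = (m \<cdot>\<^sub>v x) $ i" using l(2) i x by (simp del: index_mult_mat_vec)
qed (use x P in auto)

text \<open>Put y = (M - l) x. Then M y = l y, so P y = m y, and \<open>MM\<close> at x gives l (P -
  m) x = (l - m) y. Thus (P - m) (P - m) x = 0, whereas \<open>PP\<close> says (P - k) (P - m) x =
  0. As m and k differ, (P - m) x = 0, and y = 0 because l and m differ.\<close>

lemma eigenvalue_semisimple:
  fixes M P :: "complex mat"
  assumes M: "M \<in> carrier_mat n n" and P: "P \<in> carrier_mat n n"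
    and MM: "\<And>y. y \<in> carrier_vec n \<Longrightarrow> M *\<^sub>v (M *\<^sub>v y) + y = 2 \<cdot>\<^sub>v (P *\<^sub>v (M *\<^sub>v y))"
    and PP: "\<And>y. y \<in> carrier_vec n \<Longrightarrow> P *\<^sub>v (P *\<^sub>v y) + (m * k) \<cdot>\<^sub>v y = (m + k) \<cdot>\<^sub>v (P *\<^sub>v y)"
    and l: "l\<^sup>2 + 1 = 2 * l * m" "l \<noteq> 0" "l \<noteq> m" and mk: "m \<noteq> k"
    and x: "x \<in> carrier_vec n"
    and NN: "(M - l \<cdot>\<^sub>m 1\<^sub>m n) *\<^sub>v ((M - l \<cdot>\<^sub>m 1\<^sub>m n) *\<^sub>v x) = 0\<^sub>v n"
  shows "(M - l \<cdot>\<^sub>m 1\<^sub>m n) *\<^sub>v x = 0\<^sub>v n"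
proof -
  define y where "y = (M - l \<cdot>\<^sub>m 1\<^sub>m n) *\<^sub>v x"
  have y: "y \<in> carrier_vec n" using M x mult_mat_vec_carrier[of "M - l \<cdot>\<^sub>m 1\<^sub>m n" n n x] by (simp add: y_def minus_carrier_mat)
  have "M *\<^sub>v x - l \<cdot>\<^sub>v x = y" using char_shift_mult_vec[OF M x] y_def by simp
  then have Mx: "M *\<^sub>v x = l \<cdot>\<^sub>v x + y" using M x by auto
  have "M *\<^sub>v y - l \<cdot>\<^sub>v y = 0\<^sub>v n" using NN char_shift_mult_vec[OF M y] y_def by simp
  then have "(M *\<^sub>v y - l \<cdot>\<^sub>v y) $ i = 0" if "i < n" for i using that by simp
  then have My: "M *\<^sub>v y = l \<cdot>\<^sub>v y"
    using M y by (intro eq_vecI) (auto simp del: index_mult_mat_vec)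
  have Py: "P *\<^sub>v y = m \<cdot>\<^sub>v y" by (rule half_trace_eigenvector[OF M P MM l(1,2) y My])
  have Px: "P *\<^sub>v x \<in> carrier_vec n" using P x by simp
  have MMx: "M *\<^sub>v (M *\<^sub>v x) = l \<cdot>\<^sub>v (l \<cdot>\<^sub>v x + y) + l \<cdot>\<^sub>v y"
    using Mx My M x y mult_mat_vec[OF M x] mult_add_distrib_mat_vec[OF M, of "l \<cdot>\<^sub>v x" y] by simp
  have PMx: "P *\<^sub>v (M *\<^sub>v x) = l \<cdot>\<^sub>v (P *\<^sub>v x) + m \<cdot>\<^sub>v y"
    using Mx Py P x y mult_mat_vec[OF P x] mult_add_distrib_mat_vec[OF P, of "l \<cdot>\<^sub>v x" y] by simp
  define z where "z = P *\<^sub>v x"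
  have z: "z \<in> carrier_vec n" using Px z_def by simp
  have zi: "l * (z $ i - m * x $ i) = (l - m) * y $ i" if "i < n" for i
  proof -
    have "l * (l * x $ i + y $ i) + l * y $ i + x $ i = 2 * (l * z $ i + m * y $ i)"
      using arg_cong[OF MM[OF x, unfolded MMx PMx, folded z_def], of "\<lambda>v. v $ i"] that x y z
      by simp
    then have "2 * (l * (z $ i - m * x $ i)) = 2 * ((l - m) * y $ i)" using l(1) by Groebner_Basis.algebra
    then show ?thesis by simp
  qed
  have "l \<cdot>\<^sub>v (z - m \<cdot>\<^sub>v x) = (l - m) \<cdot>\<^sub>v y" using zi x y z by (intro eq_vecI) auto
  then have "P *\<^sub>v (l \<cdot>\<^sub>v (z - m \<cdot>\<^sub>v x)) = P *\<^sub>v ((l - m) \<cdot>\<^sub>v y)" by simp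
  then have Pz: "l \<cdot>\<^sub>v (P *\<^sub>v z - m \<cdot>\<^sub>v z) = (l - m) \<cdot>\<^sub>v (m \<cdot>\<^sub>v y)"
    using P x y z mult_mat_vec[OF P, of "z - m \<cdot>\<^sub>v x" l] mult_mat_vec[OF P x] mult_mat_vec[OF P y] Py
      mult_minus_distrib_mat_vec[OF P z, of "m \<cdot>\<^sub>v x"] z_def by simp
  define w where "w = P *\<^sub>v z"
  have w: "w \<in> carrier_vec n" using P z w_def by simp
  have "y $ i = 0" if i: "i < n" for i
  proof -
    have "l * (w $ i - m * z $ i) = (l - m) * (m * y $ i)"
      using arg_cong[OF Pz[folded w_def], of "\<lambda>v. v $ i"] i w z y by simp
    moreover have "w $ i + m * k * x $ i = (m + k) * z $ i"
      using arg_cong[OF PP[OF x, folded z_def, folded w_def], of "\<lambda>v. v $ i"] i w z x by simp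
    \<comment> \<open>By \<open>PP\<close>, w - m z = k (z - m x), so l (w - m z) equals k (l - m) y
      by \<open>zi\<close> and m (l - m) y by \<open>Pz\<close>.\<close>
    ultimately have "(l - m) * (m - k) * y $ i = 0" using zi[OF i] by Groebner_Basis.algebra
    then show ?thesis using l(3) mk by simp
  qed
  then have "y = 0\<^sub>v n" using y by (intro eq_vecI) auto
  then show ?thesis by (simp add: y_def)
qed

section \<open>Left eigenvectors of A and the B-sign\<close>

lemma eigenvector_transpose_index_2:
  fixes A :: "'a :: comm_ring_1 mat"
  assumes A: "A \<in> carrier_mat 2 2" and r: "eigenvector (transpose_mat A) r \<mu>"
  shows "r \<in> carrier_vec 2" "r $ 0 \<noteq> 0 \<or> r $ 1 \<noteq> 0"
    and "A $$ (0, 0) * r $ 0 + A $$ (1, 0) * r $ 1 = \<mu> * r $ 0"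
    and "A $$ (0, 1) * r $ 0 + A $$ (1, 1) * r $ 1 = \<mu> * r $ 1"
proof -
  show rc: "r \<in> carrier_vec 2" using r A by (simp add: eigenvector_def)
  show "r $ 0 \<noteq> 0 \<or> r $ 1 \<noteq> 0"
    using r A by (auto simp: eigenvector_def vec_eq_iff less_2_cases_iff)
  have At: "transpose_mat A \<in> carrier_mat 2 2" using A by simp
  have "A $$ (0, k) * r $ 0 + A $$ (1, k) * r $ 1 = \<mu> * r $ k" if "k < 2" for k
    using mult_mat_vec_index_2[OF At rc that] r A that rc
    by (auto simp: eigenvector_def simp del: index_mult_mat_vec)
  then show "A $$ (0, 0) * r $ 0 + A $$ (1, 0) * r $ 1 = \<mu> * r $ 0"
    "A $$ (0, 1) * r $ 0 + A $$ (1, 1) * r $ 1 = \<mu> * r $ 1" by auto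
qed

text \<open>Left eigenvectors are the rows of a diagonalising matrix: with rows \<open>r\<close> and
  \<open>w\<close>, R A = D R. Placing \<open>r\<close> first makes the entry at position (0, 0) of
  R B R^T the quadratic form of \<open>B\<close> at \<open>r\<close>.\<close>

lemma left_eigenvector_B_entry:
  assumes A: "A \<in> carrier_mat 2 2" and B: "B \<in> carrier_mat 2 2" and "\<mu> \<noteq> \<nu>"
    and r: "eigenvector (transpose_mat A) r \<mu>" and w: "eigenvector (transpose_mat A) w \<nu>"
  shows "B_entry A B \<mu> (r \<bullet> (B *\<^sub>v r))"
proof -
  note re = eigenvector_transpose_index_2[OF A r] and we = eigenvector_transpose_index_2[OF A w]
  have rc: "r \<in> carrier_vec 2" by (rule re(1))
  \<comment> \<open>The determinant of \<open>R\<close>. If it vanished, the eigenvector equations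
    would force every product of an entry of \<open>r\<close> with an entry of \<open>w\<close> to
    be 0, although both vectors are nonzero.\<close>
  define d where "d = r $ 0 * w $ 1 - r $ 1 * w $ 0"
  have d: "d \<noteq> 0"
  proof
    assume "d = 0"
    then have z: "r $ 0 * w $ 1 = r $ 1 * w $ 0" by (simp add: d_def)
    have "(\<mu> - \<nu>) * (r $ 0 * w $ 0) = 0" using re(3) we(3) z by Groebner_Basis.algebra
    moreover have "(\<mu> - \<nu>) * (r $ 1 * w $ 1) = 0" using re(4) we(4) z by Groebner_Basis.algebra
    moreover have "(\<mu> - \<nu>) * (r $ 0 * w $ 1) = 0" using re(3) we(3) z by Groebner_Basis.algebra
    ultimately show False using \<open>\<mu> \<noteq> \<nu>\<close> re(2) we(2) z by auto
  qed
  define R where "R = mat 2 2 (\<lambda>(i, j). if i = 0 then r $ j else w $ j)"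
  \<comment> \<open>The adjugate of \<open>R\<close> divided by its determinant.\<close>
  define Ri where "Ri = mat 2 2 (\<lambda>(i, j). (if i = 0 then (if j = 0 then w $ 1 else - (r $ 1))
    else (if j = 0 then - (w $ 0) else r $ 0)) / d)"
  have R: "R \<in> carrier_mat 2 2" and Ri: "Ri \<in> carrier_mat 2 2" by (auto simp: R_def Ri_def)
  have entR: "R $$ (0, k) = r $ k" "R $$ (1, k) = w $ k" if "k < 2" for k
    using that by (auto simp: R_def)
  have entRi: "Ri $$ (0, 0) = w $ 1 / d" "Ri $$ (0, 1) = - (r $ 1) / d"
    "Ri $$ (1, 0) = - (w $ 0) / d" "Ri $$ (1, 1) = r $ 0 / d" by (auto simp: Ri_def)
  have inv: "R * Ri = 1\<^sub>m 2" "Ri * R = 1\<^sub>m 2"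
    using R Ri d by (auto intro!: eq_mat_2I simp: mult_mat_index_2 entR entRi divide_simps
      mult_carrier_mat[of _ 2 2 _ 2] simp del: index_mult_mat One_nat_def) (auto simp: d_def)
  define D where "D = mat 2 2 (\<lambda>(i, j). if i = j then (if i = 0 then \<mu> else \<nu>) else 0)"
  have D: "D \<in> carrier_mat 2 2" by (simp add: D_def)
  have entD: "D $$ (0, 0) = \<mu>" "D $$ (0, 1) = 0" "D $$ (1, 0) = 0" "D $$ (1, 1) = \<nu>"
    by (auto simp: D_def)
  have "R * A = D * R"
    using R A D re(3,4) we(3,4) by (auto intro!: eq_mat_2I simp: mult_mat_index_2 entR entD mult.commute
      mult_carrier_mat[of _ 2 2 _ 2] simp del: index_mult_mat One_nat_def)
  then have RAR: "R * A * Ri = D" using D R Ri inv by (simp add: assoc_mult_mat[of _ 2 2 _ 2 _ 2])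
  have "(R * B * transpose_mat R) $$ (0, 0) = r \<bullet> (B *\<^sub>v r)"
    using mult_mat_index_2[of "R * B" "transpose_mat R" 0 0] mult_mat_index_2[OF R B] R B
      mult_mat_vec_index_2[OF B rc] rc
    by (auto simp: entR scalar_prod_def numeral_2_eq_2 algebra_simps mult_carrier_mat[of _ 2 2 _ 2]
      entR(1)[of "Suc 0", simplified] simp del: index_mult_mat index_mult_mat_vec)
  moreover have "diagonal_mat D" "D $$ (0, 0) = \<mu>" by (auto simp: D_def diagonal_mat_def)
  ultimately show ?thesis unfolding B_entry_def
    using R Ri inv RAR by (intro bexI[of _ R] bexI[of _ Ri] exI[of _ 0]) auto
qed

section \<open>The Krein form in coordinates and eigenvectors in dimension two\<close>

lemma krein_form_index:
  assumes "x \<in> carrier_vec 4"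
  shows "krein_form x x = - \<i> * (x $ 2 * cnj (x $ 0) + x $ 3 * cnj (x $ 1)
    - x $ 0 * cnj (x $ 2) - x $ 1 * cnj (x $ 3))"
proof -
  have J: "J4 *\<^sub>v x = vec 4 (\<lambda>i. if i = 0 then x $ 2 else if i = 1 then x $ 3
      else if i = 2 then - (x $ 0) else - (x $ 1))" 
    using assms by (intro eq_vecI) (auto simp: J4_def scalar_prod_def eval_nat_numeral less_Suc_eq)
  show ?thesis unfolding krein_form_def J using assms
    by (simp add: scalar_prod_def eval_nat_numeral algebra_simps)
qed

text \<open>Both eigenvalues are roots of the same monic quadratic. Subtracting the two equations
  and cancelling \<mu> - \<nu> gives the trace, and the determinant follows. This turns
  Cayley-Hamilton for \<open>A\<close> into a relation in \<mu> and \<nu>.\<close>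

lemma trace_det_eigenvalues_2:
  fixes A :: "real mat"
  assumes A: "A \<in> carrier_mat 2 2" and "\<mu> \<noteq> \<nu>"
    and r: "eigenvector (transpose_mat A) r \<mu>" and w: "eigenvector (transpose_mat A) w \<nu>"
  shows "A $$ (0, 0) + A $$ (1, 1) = \<mu> + \<nu>"
    and "A $$ (0, 0) * A $$ (1, 1) - A $$ (0, 1) * A $$ (1, 0) = \<mu> * \<nu>"
proof -
  have det: "(A $$ (0, 0) - k) * (A $$ (1, 1) - k) = A $$ (0, 1) * A $$ (1, 0)"
    if "eigenvector (transpose_mat A) v k" for v k
  proof -
    note v = eigenvector_transpose_index_2[OF A that]
    have "((A $$ (0, 0) - k) * (A $$ (1, 1) - k) - A $$ (0, 1) * A $$ (1, 0)) * v $ 0 = 0"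
      "((A $$ (0, 0) - k) * (A $$ (1, 1) - k) - A $$ (0, 1) * A $$ (1, 0)) * v $ 1 = 0"
      using v(3,4) by Groebner_Basis.algebra+
    then show ?thesis using v(2) by auto
  qed
  have "(\<mu> - \<nu>) * (A $$ (0, 0) + A $$ (1, 1) - (\<mu> + \<nu>)) = 0"
    using det[OF r] det[OF w] by Groebner_Basis.algebra
  then show tr: "A $$ (0, 0) + A $$ (1, 1) = \<mu> + \<nu>" using \<open>\<mu> \<noteq> \<nu>\<close> by simp
  show "A $$ (0, 0) * A $$ (1, 1) - A $$ (0, 1) * A $$ (1, 0) = \<mu> * \<nu>"
    using det[OF r] tr by Groebner_Basis.algebra
qed

text \<open>For a 2 x 2 matrix X, det(X v, r) + det(v, X r) = tr(X) det(v, r). If v and r both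
  satisfy the eigenvector equation for m, the left side is 2 m det(v, r), so det(v, r) = 0 unless
  the trace is 2 m. Hence a simple eigenvalue has a one-dimensional eigenspace.\<close>

lemma linear_system_2_proportional:
  fixes a b c d m r0 r1 v0 v1 :: "'a :: field"
  assumes "a * r0 + c * r1 = m * r0" "b * r0 + d * r1 = m * r1" "r0 \<noteq> 0 \<or> r1 \<noteq> 0"
    and "a * v0 + c * v1 = m * v0" "b * v0 + d * v1 = m * v1"
    and "a + d \<noteq> 2 * m"
  obtains t where "v0 = t * r0" "v1 = t * r1"
proof -
  have "(a + d - 2 * m) * (v0 * r1 - v1 * r0) = 0"
    using assms(1,2,4,5) by Groebner_Basis.algebra
  then have z: "v0 * r1 = v1 * r0" using assms(6) by simp
  show ?thesis
  proof (cases "r0 = 0")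
    case True
    then show ?thesis using that[of "v1 / r1"] z assms(3) by simp
  next
    case False
    then show ?thesis using that[of "v0 / r0"] z by (simp add: field_simps)
  qed
qed

section \<open>The block relations\<close>

text \<open>Squaring blockwise, \<open>AB\<close> and \<open>DC\<close> double the off-diagonal
  blocks, while \<open>AA\<close> and \<open>DD\<close> turn each diagonal block plus the identity
  into twice a square. \<open>D\<close> stands for the transpose of \<open>A\<close>.\<close>

lemma four_block_mat_quadratic:
  fixes A B C D :: "'a :: comm_ring_1 mat"
  assumes A: "A \<in> carrier_mat n n" and B: "B \<in> carrier_mat n n" and C: "C \<in> carrier_mat n n"
    and D: "D \<in> carrier_mat n n"
    and AB: "A * B = B * D" and DC: "D * C = C * A"
    and AA: "A * A = B * C + 1\<^sub>m n" and DD: "D * D = C * B + 1\<^sub>m n"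
  defines "M \<equiv> four_block_mat A B C D"
    and "P \<equiv> four_block_mat A (0\<^sub>m n n) (0\<^sub>m n n) D"
  shows "M * M + 1\<^sub>m (n + n) = 2 \<cdot>\<^sub>m (P * M)"
proof -
  have [simp]: "X * Y \<in> carrier_mat n n" if "X \<in> carrier_mat n n" "Y \<in> carrier_mat n n"
    for X Y :: "'a mat" using that by (rule mult_carrier_mat)
  have PM: "P * M = four_block_mat (A * A) (A * B) (D * C) (D * D)"
    unfolding M_def P_def using A B C D
    by (subst mult_four_block_mat[of _ n n _ n _ n _ _ n _ n]) auto
  have MM: "M * M = four_block_mat (A * A + B * C) (A * B + A * B) (D * C + D * C) (C * B + D * D)"
    unfolding M_def using A B C D
    by (subst mult_four_block_mat[of _ n n _ n _ n _ _ n _ n]) (auto simp: AB DC)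
  have "M * M + 1\<^sub>m (n + n) = four_block_mat (A * A + B * C + 1\<^sub>m n) (A * B + A * B + 0\<^sub>m n n)
      (D * C + D * C + 0\<^sub>m n n) (C * B + D * D + 1\<^sub>m n)"
    unfolding MM four_block_one_mat[symmetric] using A B C D
    by (subst add_four_block_mat[of _ n n _ n _ n]) auto
  also have "A * A + B * C + 1\<^sub>m n = 2 \<cdot>\<^sub>m (A * A)"
    \<comment> \<open>Keeping the entries of products unexpanded reduces this identity, and the next
      three, to linear arithmetic in each entry.\<close>
    unfolding AA using A B C D by (intro eq_matI) (auto simp: algebra_simps simp del: index_mult_mat(1))
  also have "A * B + A * B + 0\<^sub>m n n = 2 \<cdot>\<^sub>m (A * B)"
    using A B by (intro eq_matI) (auto simp: algebra_simps simp del: index_mult_mat(1))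
  also have "D * C + D * C + 0\<^sub>m n n = 2 \<cdot>\<^sub>m (D * C)"
    using C D by (intro eq_matI) (auto simp: algebra_simps simp del: index_mult_mat(1))
  also have "C * B + D * D + 1\<^sub>m n = 2 \<cdot>\<^sub>m (D * D)"
    unfolding DD using A B C D by (intro eq_matI) (auto simp: algebra_simps simp del: index_mult_mat(1))
  finally show ?thesis unfolding PM using A B C D
    by (subst smult_four_block_mat[of _ n n _ n _ n]) auto
qed

lemma SpI4_blockD:
  assumes A: "A \<in> carrier_mat 2 2" and B: "B \<in> carrier_mat 2 2" and C: "C \<in> carrier_mat 2 2"
    and M: "M_block A B C \<in> SpI4"
  shows "A * B = B * transpose_mat A" "transpose_mat A * C = C * A"
    and "A * A = B * C + 1\<^sub>m 2" "transpose_mat A * transpose_mat A = C * B + 1\<^sub>m 2"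
proof -
  from M obtain A' B' C' where eq: "M_block A B C = M_block A' B' C'"
    and A': "A' \<in> carrier_mat 2 2" and B': "B' \<in> carrier_mat 2 2" and C': "C' \<in> carrier_mat 2 2"
    and rel: "B' = transpose_mat B'" "C' = transpose_mat C'" "A' * B' = B' * transpose_mat A'"
      "transpose_mat A' * C' = C' * A'" "A' * A' - B' * C' = 1\<^sub>m 2"
    unfolding SpI4_def by blast
  have "A = A' \<and> B = B' \<and> C = C' \<and> transpose_mat A = transpose_mat A'"
    using four_block_mat_inject[of A 2 B C "transpose_mat A" A' B' C' "transpose_mat A'"]
      eq A B C A' B' C' unfolding M_block_def by simp
  then have e: "A' = A" "B' = B" "C' = C" by auto
  show "A * B = B * transpose_mat A" "transpose_mat A * C = C * A" using rel e by auto
  have "A * A - B * C = 1\<^sub>m 2" using rel(5) e by simp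
  moreover have "A * A = B * C + (A * A - B * C)"
    using A B C by (intro eq_matI) (auto simp del: index_mult_mat(1))
  ultimately show AA: "A * A = B * C + 1\<^sub>m 2" by simp
  \<comment> \<open>The last relation is the transpose of the previous one; symmetry of
    \<open>B\<close> and \<open>C\<close> turns C^T B^T into C B.\<close>
  have "transpose_mat A * transpose_mat A = transpose_mat (A * A)"
    using transpose_mult[OF A A] by simp
  also have "\<dots> = transpose_mat C * transpose_mat B + 1\<^sub>m 2"
    unfolding AA using B C transpose_add[of "B * C" 2 2 "1\<^sub>m 2"] transpose_mult[OF B C]
    by (simp add: mult_carrier_mat[of _ 2 2 _ 2])
  finally show "transpose_mat A * transpose_mat A = C * B + 1\<^sub>m 2" using rel(1,2) e by simp
qed

section \<open>The generalised eigenspace and its Krein form\<close>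

text \<open>For c (q, i s r) the factor i makes the two halves of the form add up instead of
  cancelling, and c enters only through c times its conjugate. So all nonzero multiples of one
  vector have the same Krein sign.\<close>

lemma krein_form_eigenvector:
  assumes x: "x \<in> carrier_vec 4" and r: "r \<in> carrier_vec 2" and q: "q \<in> carrier_vec 2"
    and "\<And>k. k < 2 \<Longrightarrow> x $ k = c * complex_of_real (q $ k)"
    and "\<And>k. k < 2 \<Longrightarrow> x $ (k + 2) = c * (\<i> * complex_of_real s * complex_of_real (r $ k))"
  shows "krein_form x x = complex_of_real (2 * s * (cmod c)\<^sup>2 * (r \<bullet> q))"
proof -
  have x: "krein_form x x = - \<i> * (x $ 2 * cnj (x $ 0) + x $ 3 * cnj (x $ 1)
    - x $ 0 * cnj (x $ 2) - x $ 1 * cnj (x $ 3))" by (rule krein_form_index[OF x])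
  have e: "x $ 0 = c * complex_of_real (q $ 0)" "x $ 1 = c * complex_of_real (q $ 1)"
    "x $ 2 = c * (\<i> * complex_of_real s * complex_of_real (r $ 0))"
    "x $ 3 = c * (\<i> * complex_of_real s * complex_of_real (r $ 1))"
    using assms(4)[of 0] assms(4)[of 1] assms(5)[of 0] assms(5)[of 1] by (auto simp: eval_nat_numeral)
  have "krein_form x x = 2 * of_real s * (c * cnj c) * of_real (r $ 0 * q $ 0 + r $ 1 * q $ 1)"
    unfolding x e by (simp add: algebra_simps)
  also have "c * cnj c = of_real ((cmod c)\<^sup>2)" by (rule complex_norm_square[symmetric])
  also have "r $ 0 * q $ 0 + r $ 1 * q $ 1 = r \<bullet> q"
    using q by (simp add: scalar_prod_def numeral_2_eq_2)
  finally show ?thesis by simp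
qed

lemma gen_eigenspace_SpI4:
  fixes A B C :: "real mat" and \<mu> \<nu> :: real and l :: complex and r w :: "real vec"
  assumes A: "A \<in> carrier_mat 2 2" and B: "B \<in> carrier_mat 2 2" and C: "C \<in> carrier_mat 2 2"
    and M: "M_block A B C \<in> SpI4" and mn: "\<mu> \<noteq> \<nu>"
    and r: "eigenvector (transpose_mat A) r \<mu>" and w: "eigenvector (transpose_mat A) w \<nu>"
    and mu: "-1 < \<mu>" "\<mu> < 1"
    and l: "l = complex_of_real \<mu> + \<i> * complex_of_real s" and s: "s = sqrt (1 - \<mu>\<^sup>2)"
  shows "\<exists>x. eigenvector (cmat (M_block A B C)) x l \<and> x \<in> gen_eigenspace (M_block A B C) l \<and>
      krein_form x x = complex_of_real (2 * s * (r \<bullet> (B *\<^sub>v r)))"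
    and "x \<in> gen_eigenspace (M_block A B C) l \<Longrightarrow> x \<noteq> 0\<^sub>v 4 \<Longrightarrow>
      \<exists>c. c \<noteq> 0 \<and> krein_form x x = complex_of_real (2 * s * (cmod c)\<^sup>2 * (r \<bullet> (B *\<^sub>v r)))"
proof -
  note rel = SpI4_blockD[OF A B C M]
  let ?At = "transpose_mat A"
  have At: "?At \<in> carrier_mat 2 2" using A by simp
  note re = eigenvector_transpose_index_2[OF A r]
  have rc: "r \<in> carrier_vec 2" by (rule re(1))
  have Atr: "?At *\<^sub>v r = \<mu> \<cdot>\<^sub>v r" using r by (simp add: eigenvector_def)
  define q where "q = B *\<^sub>v r"
  have q: "q \<in> carrier_vec 2" using B rc by (simp add: q_def)
  have "\<mu>\<^sup>2 < 1" using mu by (simp add: abs_square_less_1)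
  then have s0: "s > 0" and s2: "s\<^sup>2 = 1 - \<mu>\<^sup>2" using s by auto
  have s2c: "(complex_of_real s)\<^sup>2 = 1 - (complex_of_real \<mu>)\<^sup>2"
    using arg_cong[OF s2, of complex_of_real] by simp
  \<comment> \<open>\<open>l\<close> lies on the unit circle with real part \<mu>, hence is a root
    of t^2 - 2 \<mu> t + 1.\<close>
  have l2: "l\<^sup>2 + 1 = 2 * l * complex_of_real \<mu>"
    unfolding l using s2c by (simp add: power2_eq_square algebra_simps)
  have lm: "l \<noteq> complex_of_real \<mu>" using l s0 by simp
  have l0: "l \<noteq> 0" using l2 by auto
  define M where "M = cmat (M_block A B C)"
  define P where "P = four_block_mat (cmat A) (0\<^sub>m 2 2) (0\<^sub>m 2 2) (cmat ?At)"
  have M_eq: "M = four_block_mat (cmat A) (cmat B) (cmat C) (cmat ?At)"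
    unfolding M_def M_block_def using A B C At by (intro map_four_block_mat)
  have M4: "M \<in> carrier_mat 4 4" and P4: "P \<in> carrier_mat 4 4"
    using A B C At four_block_carrier_mat[of "cmat A" 2 2 "cmat ?At" 2 2] by (simp_all add: M_eq P_def)
  have cA: "cmat A \<in> carrier_mat 2 2" and cB: "cmat B \<in> carrier_mat 2 2"
    and cC: "cmat C \<in> carrier_mat 2 2" and cAt: "cmat ?At \<in> carrier_mat 2 2" using A B C by auto
  have cadd: "cmat (X + Y) = cmat X + cmat Y" if "X \<in> carrier_mat 2 2" "Y \<in> carrier_mat 2 2" for X Y
    using that by (intro eq_matI) auto
  note cmult = of_real_hom.mat_hom_mult[where 'a = complex]
  have MMP: "M * M + 1\<^sub>m (2 + 2) = 2 \<cdot>\<^sub>m (P * M)"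
    unfolding M_eq P_def
  proof (rule four_block_mat_quadratic[OF cA cB cC cAt])
    show "cmat A * cmat B = cmat B * cmat ?At"
      using rel(1) cmult[OF A B] cmult[OF B At] by simp
    show "cmat ?At * cmat C = cmat C * cmat A"
      using rel(2) cmult[OF At C] cmult[OF C A] by simp
    show "cmat A * cmat A = cmat B * cmat C + 1\<^sub>m 2"
      using rel(3) cmult[OF A A] cmult[OF B C] cadd[of "B * C" "1\<^sub>m 2"] B C
      by (simp add: mult_carrier_mat[of _ 2 2 _ 2] of_real_hom.mat_hom_one)
    show "cmat ?At * cmat ?At = cmat C * cmat B + 1\<^sub>m 2"
      using rel(4) cmult[OF At At] cmult[OF C B] cadd[of "C * B" "1\<^sub>m 2"] B C
      by (simp add: mult_carrier_mat[of _ 2 2 _ 2] of_real_hom.mat_hom_one)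
  qed
  have MM: "M *\<^sub>v (M *\<^sub>v y) + y = 2 \<cdot>\<^sub>v (P *\<^sub>v (M *\<^sub>v y))" if y: "y \<in> carrier_vec 4" for y
  proof -
    have "M *\<^sub>v (M *\<^sub>v y) + y = (M * M + 1\<^sub>m 4) *\<^sub>v y"
      using M4 y add_mult_distrib_mat_vec[of "M * M" 4 4 "1\<^sub>m 4" y]
      by (simp add: mult_carrier_mat[of _ 4 4 _ 4])
    also have "\<dots> = (2 \<cdot>\<^sub>m (P * M)) *\<^sub>v y" using MMP by simp
    also have "\<dots> = 2 \<cdot>\<^sub>v (P *\<^sub>v (M *\<^sub>v y))"
      using M4 P4 y smult_mat_mult_vec[of "P * M" 4 4 y 2]
      by (simp add: mult_carrier_mat[of _ 4 4 _ 4])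
    finally show ?thesis .
  qed
  define a b c d where "a = complex_of_real (A $$ (0, 0))" and "b = complex_of_real (A $$ (0, 1))"
    and "c = complex_of_real (A $$ (1, 0))" and "d = complex_of_real (A $$ (1, 1))"
  note abcd = a_def b_def c_def d_def
  have tr: "a + d = of_real \<mu> + of_real \<nu>"
    and dt: "a * d - b * c = of_real \<mu> * of_real \<nu>"
    using arg_cong[OF trace_det_eigenvalues_2(1)[OF A mn r w], of complex_of_real]
      arg_cong[OF trace_det_eigenvalues_2(2)[OF A mn r w], of complex_of_real]
    by (auto simp: abcd)
  have Pi: "(P *\<^sub>v y) $ 0 = a * y $ 0 + b * y $ 1" "(P *\<^sub>v y) $ 1 = c * y $ 0 + d * y $ 1"
    "(P *\<^sub>v y) $ 2 = a * y $ 2 + c * y $ 3" "(P *\<^sub>v y) $ 3 = b * y $ 2 + d * y $ 3"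
    \<comment> \<open>The lower block of \<open>P\<close> is the transpose of \<open>A\<close>, so
      \<open>b\<close> and \<open>c\<close> trade places in the last two entries.\<close>
    if y: "y \<in> carrier_vec 4" for y
    using four_block_mat_mult_vec_index[OF cA zero_carrier_mat zero_carrier_mat cAt y, of 0]
      four_block_mat_mult_vec_index[OF cA zero_carrier_mat zero_carrier_mat cAt y, of 1] A
    by (auto simp: P_def abcd eval_nat_numeral simp del: index_mult_mat_vec)
  have half: "k < 2 \<or> (\<exists>j<2. k = j + 2)" if "k < 4" for k :: nat using that by presburger
  have less4: "k < 4 \<longleftrightarrow> k = 0 \<or> k = 1 \<or> k = 2 \<or> k = 3" for k :: nat by auto
  have PP: "P *\<^sub>v (P *\<^sub>v y) + (of_real \<mu> * of_real \<nu>) \<cdot>\<^sub>v y = (of_real \<mu> + of_real \<nu>) \<cdot>\<^sub>v (P *\<^sub>v y)"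
    if y: "y \<in> carrier_vec 4" for y
  proof
    show "dim_vec (P *\<^sub>v (P *\<^sub>v y) + (of_real \<mu> * of_real \<nu>) \<cdot>\<^sub>v y)
      = dim_vec ((of_real \<mu> + of_real \<nu>) \<cdot>\<^sub>v (P *\<^sub>v y))" using P4 y by simp
    fix k assume "k < dim_vec ((of_real \<mu> + of_real \<nu>) \<cdot>\<^sub>v (P *\<^sub>v y))"
    then have k: "k < 4" using P4 by simp
    have Py: "P *\<^sub>v y \<in> carrier_vec 4" using P4 y by simp
    \<comment> \<open>Cayley-Hamilton, checked at once for \<open>A\<close> and its transpose, which
      share trace and determinant.\<close>
    have "(P *\<^sub>v (P *\<^sub>v y)) $ k + (a * d - b * c) * y $ k = (a + d) * (P *\<^sub>v y) $ k"
      using k unfolding less4 by (elim disjE) (simp_all only: Pi[OF Py] Pi[OF y], simp_all add: algebra_simps)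
    then show "(P *\<^sub>v (P *\<^sub>v y) + (of_real \<mu> * of_real \<nu>) \<cdot>\<^sub>v y) $ k
      = ((of_real \<mu> + of_real \<nu>) \<cdot>\<^sub>v (P *\<^sub>v y)) $ k"
      unfolding tr dt using k P4 y by (simp del: index_mult_mat_vec)
  qed
  define N where "N = M - l \<cdot>\<^sub>m 1\<^sub>m 4"
  have N4: "N \<in> carrier_mat 4 4" using M4 by (simp add: N_def minus_carrier_mat)
  have kerN: "N *\<^sub>v y = 0\<^sub>v 4 \<longleftrightarrow> M *\<^sub>v y = l \<cdot>\<^sub>v y" if y: "y \<in> carrier_vec 4" for y
    unfolding N_def char_shift_mult_vec[OF M4 y] using M4 y
    by (auto simp: vec_eq_iff simp del: index_mult_mat_vec)
  have mnc: "complex_of_real \<mu> \<noteq> complex_of_real \<nu>" using mn by simp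
  have semisimple: "N *\<^sub>v y = 0\<^sub>v 4" if "y \<in> carrier_vec 4" "N *\<^sub>v (N *\<^sub>v y) = 0\<^sub>v 4" for y
    using eigenvalue_semisimple[OF M4 P4 MM PP l2 l0 lm mnc, of y] that unfolding N_def by blast
  have gen: "M *\<^sub>v y = l \<cdot>\<^sub>v y" "y \<in> carrier_vec 4" if mem: "y \<in> gen_eigenspace (M_block A B C) l" for y
  proof -
    obtain m where "m \<ge> 1" "y \<in> mat_kernel (N ^\<^sub>m m)"
      using mem unfolding gen_eigenspace_def N_def M_def by auto
    \<comment> \<open>The exponent 0 is excluded from the union, so \<open>mat_pow_kernel_eq\<close>
      applies to every power occurring in it.\<close>
    moreover then obtain k where "m = Suc k" by (cases m) auto
    ultimately have y: "y \<in> carrier_vec 4" and "N ^\<^sub>m Suc k *\<^sub>v y = 0\<^sub>v 4"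
      using mat_kernelD[OF pow_carrier_mat[OF N4]] by blast+
    then have "N *\<^sub>v y = 0\<^sub>v 4" using mat_pow_kernel_eq[OF N4, of y k] semisimple by blast
    then show "M *\<^sub>v y = l \<cdot>\<^sub>v y" "y \<in> carrier_vec 4" using kerN[OF y] y by auto
  qed

  \<comment> \<open>With q = B r, moving \<open>A\<close> past \<open>B\<close> lets its transpose
    act on \<open>r\<close>; likewise C B r is ((A^T)^2 - I) r. These two facts evaluate
    \<open>M\<close> on (q, i s r).\<close>
  have Aq: "A *\<^sub>v q = \<mu> \<cdot>\<^sub>v q"
  proof -
    have "A *\<^sub>v q = (B * ?At) *\<^sub>v r"
      unfolding q_def using assoc_mult_mat_vec[OF A B rc] rel(1) by simp
    also have "\<dots> = B *\<^sub>v (\<mu> \<cdot>\<^sub>v r)" using assoc_mult_mat_vec[OF B At rc] Atr by simp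
    finally show ?thesis unfolding q_def using mult_mat_vec[OF B rc] by simp
  qed
  have Cq: "(C *\<^sub>v q) $ k = (\<mu>\<^sup>2 - 1) * r $ k" if "k < 2" for k
  proof -
    have "(C * B + 1\<^sub>m 2) *\<^sub>v r = \<mu> \<cdot>\<^sub>v (\<mu> \<cdot>\<^sub>v r)"
      unfolding rel(4)[symmetric] using assoc_mult_mat_vec[OF At At rc] Atr mult_mat_vec[OF At rc] by simp
    moreover have "(C * B + 1\<^sub>m 2) *\<^sub>v r = C *\<^sub>v q + r"
      unfolding q_def using B C rc add_mult_distrib_mat_vec[of "C * B" 2 2 "1\<^sub>m 2" r]
      by (simp add: mult_carrier_mat[of _ 2 2 _ 2])
    ultimately have "(C *\<^sub>v q + r) $ k = (\<mu> \<cdot>\<^sub>v (\<mu> \<cdot>\<^sub>v r)) $ k" by simp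
    then show ?thesis
      using that C q rc by (simp add: power2_eq_square algebra_simps del: index_mult_mat_vec)
  qed
  have cmv: "of_real (X $$ (k, 0)) * of_real (v $ 0) + of_real (X $$ (k, 1)) * of_real (v $ 1)
      = complex_of_real ((X *\<^sub>v v) $ k)"
    if "X \<in> carrier_mat 2 2" "v \<in> carrier_vec 2" "k < 2" for X v k
    using mult_mat_vec_index_2[OF that] by simp
  define x0 where "x0 = vec 4 (\<lambda>k. if k < 2 then complex_of_real (q $ k)
    else \<i> * complex_of_real s * complex_of_real (r $ (k - 2)))"
  have x0c: "x0 \<in> carrier_vec 4" by (simp add: x0_def)
  have x0e: "x0 $ 0 = of_real (q $ 0)" "x0 $ 1 = of_real (q $ 1)"
    "x0 $ 2 = \<i> * of_real s * of_real (r $ 0)" "x0 $ 3 = \<i> * of_real s * of_real (r $ 1)"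
    by (simp_all add: x0_def)
  have Mx0: "(M *\<^sub>v x0) $ k = l * x0 $ k" "(M *\<^sub>v x0) $ (k + 2) = l * x0 $ (k + 2)" if k: "k < 2" for k
  proof -
    have "(M *\<^sub>v x0) $ k = of_real ((A *\<^sub>v q) $ k) + \<i> * of_real s * of_real ((B *\<^sub>v r) $ k)"
      unfolding M_eq four_block_mat_mult_vec_index(1)[OF cA cB cC cAt x0c k] x0e
        cmv[OF A q k, symmetric] cmv[OF B rc k, symmetric] using A B k
      by (simp add: algebra_simps)
    then show "(M *\<^sub>v x0) $ k = l * x0 $ k"
      using k q unfolding Aq q_def[symmetric] l by (simp add: x0_def algebra_simps)
    have "(M *\<^sub>v x0) $ (k + 2) = of_real ((C *\<^sub>v q) $ k) + \<i> * of_real s * of_real ((?At *\<^sub>v r) $ k)"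
      unfolding M_eq four_block_mat_mult_vec_index(2)[OF cA cB cC cAt x0c k] x0e
        cmv[OF C q k, symmetric] cmv[OF At rc k, symmetric] using A C k
      by (simp add: algebra_simps)
    also have "\<dots> = - (of_real s)\<^sup>2 * of_real (r $ k) + \<i> * of_real s * of_real \<mu> * of_real (r $ k)"
      using k rc unfolding Cq[OF k] Atr s2c by (simp add: algebra_simps)
    also have "\<dots> = l * x0 $ (k + 2)"
      using k unfolding l by (simp add: x0_def power2_eq_square algebra_simps)
    finally show "(M *\<^sub>v x0) $ (k + 2) = l * x0 $ (k + 2)" .
  qed
  have "M *\<^sub>v x0 = l \<cdot>\<^sub>v x0"
  proof
    fix k assume "k < dim_vec (l \<cdot>\<^sub>v x0)"
    then show "(M *\<^sub>v x0) $ k = (l \<cdot>\<^sub>v x0) $ k"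
      using half[of k] Mx0 x0c by (auto simp del: index_mult_mat_vec add_2_eq_Suc')
  qed (use M4 x0c in auto)
  moreover have "x0 \<noteq> 0\<^sub>v 4"
  proof
    assume "x0 = 0\<^sub>v 4"
    \<comment> \<open>The lower half i s r is nonzero since s > 0.\<close>
    then have "x0 $ 2 = 0" "x0 $ 3 = 0" by auto
    then show False using x0e s0 re(2) by auto
  qed
  ultimately have ev: "eigenvector M x0 l" using M4 x0c by (simp add: eigenvector_def)
  have "N ^\<^sub>m 1 *\<^sub>v x0 = 0\<^sub>v 4"
    using kerN[OF x0c] \<open>M *\<^sub>v x0 = l \<cdot>\<^sub>v x0\<close> N4 by simp
  then have "x0 \<in> mat_kernel (N ^\<^sub>m 1)" by (intro mat_kernelI[OF pow_carrier_mat[OF N4] x0c])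
  then have "x0 \<in> gen_eigenspace (M_block A B C) l"
    unfolding gen_eigenspace_def N_def M_def by blast
  moreover have "krein_form x0 x0 = complex_of_real (2 * s * (cmod 1)\<^sup>2 * (r \<bullet> q))"
    by (rule krein_form_eigenvector[OF x0c rc q]) (auto simp: x0_def)
  ultimately show "\<exists>x. eigenvector (cmat (M_block A B C)) x l \<and> x \<in> gen_eigenspace (M_block A B C) l \<and>
      krein_form x x = complex_of_real (2 * s * (r \<bullet> (B *\<^sub>v r)))"
    using ev unfolding M_def q_def by auto

  assume mem: "x \<in> gen_eigenspace (M_block A B C) l" and nz: "x \<noteq> 0\<^sub>v 4"
  note Mx = gen(1)[OF mem] and x = gen(2)[OF mem]
  have Px: "P *\<^sub>v x = of_real \<mu> \<cdot>\<^sub>v x" by (rule half_trace_eigenvector[OF M4 P4 MM l2 l0 x Mx])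
  \<comment> \<open>The lower half of P x = \<mu> x is the eigenvector equation of the transpose of
    \<open>A\<close>, whose \<mu>-eigenspace is spanned by \<open>r\<close> because \<nu> differs
    from \<mu>.\<close>
  obtain t where t: "x $ 2 = t * of_real (r $ 0)" "x $ 3 = t * of_real (r $ 1)"
  proof (rule linear_system_2_proportional)
    show "a * of_real (r $ 0) + c * of_real (r $ 1) = of_real \<mu> * of_real (r $ 0)"
      "b * of_real (r $ 0) + d * of_real (r $ 1) = of_real \<mu> * of_real (r $ 1)"
      using arg_cong[OF re(3), of complex_of_real] arg_cong[OF re(4), of complex_of_real]
      by (auto simp: abcd)
    show "complex_of_real (r $ 0) \<noteq> 0 \<or> complex_of_real (r $ 1) \<noteq> 0" using re(2) by simp
    show "a * x $ 2 + c * x $ 3 = of_real \<mu> * x $ 2" "b * x $ 2 + d * x $ 3 = of_real \<mu> * x $ 3"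
      using Pi(3,4)[OF x] Px x by auto
    show "a + d \<noteq> 2 * of_real \<mu>" using tr mn by simp
  qed
  \<comment> \<open>Rescaled so that the lower half of \<open>x\<close> is \<open>e\<close> times
    the lower half i s r of \<open>x0\<close>.\<close>
  define e where "e = t / (\<i> * of_real s)"
  have te: "t = e * (\<i> * of_real s)" using s0 by (simp add: e_def)
  have lo: "x $ (k + 2) = e * (\<i> * of_real s * of_real (r $ k))" if "k < 2" for k
    using that t te by (auto simp: less_Suc_eq eval_nat_numeral mult.assoc)
  have hi: "x $ k = e * of_real (q $ k)" if k: "k < 2" for k
  proof -
    \<comment> \<open>The upper half of M x = l x reads l x = \<mu> x + t q there, since
      \<open>P\<close> already accounts for the block \<open>A\<close>. Subtracting \<mu> x leaves i
      s x = i s e q.\<close>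
    have "l * x $ k = (M *\<^sub>v x) $ k" using Mx k x by simp
    also have "\<dots> = (P *\<^sub>v x) $ k + (of_real (B $$ (k, 0)) * x $ 2 + of_real (B $$ (k, 1)) * x $ 3)"
      unfolding M_eq P_def four_block_mat_mult_vec_index(1)[OF cA cB cC cAt x k]
        four_block_mat_mult_vec_index(1)[OF cA zero_carrier_mat zero_carrier_mat cAt x k]
      using B k by simp
    also have "\<dots> = of_real \<mu> * x $ k + t * of_real (q $ k)"
      unfolding Px q_def cmv[OF B rc k, symmetric] t using k x by (simp add: algebra_simps)
    finally have "\<i> * of_real s * x $ k = \<i> * of_real s * (e * of_real (q $ k))"
      unfolding l te by (simp add: algebra_simps)
    then show ?thesis using s0 by simp
  qed
  have "e \<noteq> 0"
  proof
    assume "e = 0"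
    then have "x $ k = 0" if "k < 4" for k
      using half[OF that] hi lo by (auto simp del: add_2_eq_Suc')
    then show False using nz x by auto
  qed
  then show "\<exists>c. c \<noteq> 0 \<and> krein_form x x = complex_of_real (2 * s * (cmod c)\<^sup>2 * (r \<bullet> (B *\<^sub>v r)))"
    using krein_form_eigenvector[OF x rc q hi lo] unfolding q_def by blast
qed

section \<open>Comparison of the two signs\<close>

theorem lemma3p4:
  fixes A B C :: "real mat" and \<mu> :: real and l :: complex
  assumes "A \<in> carrier_mat 2 2" and "B \<in> carrier_mat 2 2" and "C \<in> carrier_mat 2 2"
    and "M_block A B C \<in> SpI4"
    and "card (spectrum A) = 2"
    and "1 \<notin> spectrum A" and "-1 \<notin> spectrum A"
    and "eigenvalue A \<mu>" and "-1 < \<mu>" and "\<mu> < 1"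
    and "l = complex_of_real \<mu> + \<i> * complex_of_real (sqrt (1 - \<mu>\<^sup>2))"
  shows "eigenvalue (cmat (M_block A B C)) l \<and>
    (B_positive A B \<mu> \<longleftrightarrow> krein_positive (M_block A B C) l) \<and>
    (B_negative A B \<mu> \<longleftrightarrow> krein_negative (M_block A B C) l)"
proof -
  note A = assms(1) and B = assms(2)
  have "\<mu> \<in> spectrum A" using assms(8) by (simp add: spectrum_def)
  moreover obtain k k' where "spectrum A = {k, k'}" "k \<noteq> k'"
    using assms(5) by (auto simp: card_2_iff)
  ultimately obtain \<nu> where "\<nu> \<in> spectrum A" and mn: "\<mu> \<noteq> \<nu>" by auto
  then have "eigenvalue A \<nu>" by (simp add: spectrum_def)
  \<comment> \<open>A matrix and its transpose have the same characteristic polynomial, so left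
    eigenvectors exist for both eigenvalues.\<close>
  then have "eigenvalue (transpose_mat A) \<mu>" "eigenvalue (transpose_mat A) \<nu>"
    using assms(8) A eigenvalue_root_char_poly[OF A]
      eigenvalue_root_char_poly[of "transpose_mat A" 2] by auto
  then obtain r w where r: "eigenvector (transpose_mat A) r \<mu>"
    and w: "eigenvector (transpose_mat A) w \<nu>" unfolding eigenvalue_def by blast
  define b where "b = r \<bullet> (B *\<^sub>v r)"
  have "B_entry A B \<mu> b"
    unfolding b_def by (rule left_eigenvector_B_entry[OF A B mn r w])
  \<comment> \<open>Independence of the diagonalising matrix reduces the existential definitions of
    the B-signs to the sign of the single number \<open>b\<close>.\<close>
  then have "sgn b' = sgn b" if "B_entry A B \<mu> b'" for b'
    using B_entry_sgn_unique[OF A B assms(5)] that by blast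
  then have Bpos: "B_positive A B \<mu> \<longleftrightarrow> b > 0" and Bneg: "B_negative A B \<mu> \<longleftrightarrow> b < 0"
    unfolding B_positive_def B_negative_def using \<open>B_entry A B \<mu> b\<close> by (metis sgn_less sgn_greater)+
  define s where "s = sqrt (1 - \<mu>\<^sup>2)"
  have "\<mu>\<^sup>2 < 1" using assms(9,10) by (simp add: abs_square_less_1)
  then have s: "s > 0" by (simp add: s_def)
  note E = gen_eigenspace_SpI4[OF A B assms(3,4) mn r w assms(9,10) assms(11)[folded s_def] s_def,
      folded b_def]
  obtain x where x: "eigenvector (cmat (M_block A B C)) x l" "x \<in> gen_eigenspace (M_block A B C) l"
    "krein_form x x = complex_of_real (2 * s * b)" using E(1) by blast
  then have ev: "eigenvalue (cmat (M_block A B C)) l" by (auto simp: eigenvalue_def)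
  have "dim_row (cmat (M_block A B C)) = 4" using A by (simp add: M_block_def)
  then have x0: "x \<noteq> 0\<^sub>v 4" using x(1) by (auto simp: eigenvector_def)
  have "cmod l = 1"
    using \<open>\<mu>\<^sup>2 < 1\<close> unfolding assms(11) by (simp add: cmod_def)
  moreover have "krein_form y y \<in> \<real> \<and> sgn (Re (krein_form y y)) = sgn b"
    if y: "y \<in> gen_eigenspace (M_block A B C) l" "y \<noteq> 0\<^sub>v 4" for y
  proof -
    obtain c where "c \<noteq> 0" "krein_form y y = complex_of_real (2 * s * (cmod c)\<^sup>2 * b)"
      using E(2)[OF y] by blast
    then show ?thesis using s by (simp add: sgn_mult del: of_real_mult)
  qed
  \<comment> \<open>The explicit nonzero vector \<open>x\<close> gives the direction from the Krein
    sign to the sign of \<open>b\<close>: definiteness cannot hold vacuously.\<close>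
  ultimately have "krein_positive (M_block A B C) l \<longleftrightarrow> b > 0"
    "krein_negative (M_block A B C) l \<longleftrightarrow> b < 0"
    unfolding krein_positive_def krein_negative_def using ev x(2) x0
    by (metis sgn_less sgn_greater)+
  then show ?thesis using ev Bpos Bneg by simp
qed

end
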